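(* Let $X$ be a valid XDI state machine with set of states $S$, let $h$ be a handshake, let $E$ be an environment, and let $s\in S$. If the procedure $\mathrm{Gb}$ defined in the context, started on $s$ with empty accumulator, does not fail, i.e. $\mathrm{Gb}(\mathrm{nil},s)\neq\mathrm{nil}$, then $\mathbf{G}_{\mathrm{spec}}(X,h,s,E)$ holds.
   Context: A valid XDI state machine $X$ consists of a finite set $S$ of states with exactly one initial state $s_{\mathrm{init}}\in S$. Each state has a type, BOX or TRANSIENT, and a finite (ordered) list of transitions $(w,s')$, where $s'\in S$ and the wire $w=(h,k,d)$ consists of a handshake $h$, a kind $k\in\{R,A\}$ (request or acknowledgment) and a direction $d\in\{I,O\}$ (input or output). An environment $E$ is a set of pairs $(h,k)$, the wires deemed stable. A transition labelled $(h,k,d)$ cannot occur if $(h,k)\in E$. $\mathrm{step}_E(s)$ is the list of targets of those transitions of $s$ that can occur. A trace (relative to $E$) is a finite non-empty sequence of states in which each state after the first lies in $\mathrm{step}_E$ of its predecessor (a single state is a trace). Labelling: for a handshake $h$, define $\mathrm{visit}(s,f,r)$, with $f$ a Boolean flag and $r$ an association list from states to Booleans: if $s$ already has an entry in $r$, return $r$; otherwise add the entry $(s,f)$ to $r$ and then, for each transition $(w,s')$ of $s$ in list order, replace $r$ by $\mathrm{visit}(s',f',r)$, where $f'=\neg f$ if $w$ is a wire of handshake $h$ and $f'=f$ otherwise; finally return $r$. A state $s$ is called blocking $h$ iff its entry in $\mathrm{visit}(s_{\mathrm{init}},\mathrm{false},\emptyset)$ is true. Specification: $\mathbf{G}_{\mathrm{spec}}(X,h,s,E)$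 holds iff every trace (relative to $E$) starting in $s$ ends in a state that is TRANSIENT or blocking $h$. Executable procedure (for fixed $X,h,E$), where $V$ is a finite list of (visited) states, $\mathrm{nil}$ is the empty list, and returning $\mathrm{nil}$ signifies failure; $\mathrm{Gb}$ and $\mathrm{Gbs}$ are mutually recursive: - $\mathrm{Gb}(V,s)$: if $s\in V$, return $V$. Otherwise, if $s$ is TRANSIENT or blocking $h$, return $\mathrm{Gbs}(s::V,\ L)$, where $L$ is $\mathrm{step}_E(s)$ with all occurrences of $s$ removed. Otherwise return $\mathrm{nil}$. - $\mathrm{Gbs}(V,L)$: if $L$ is empty, return $V$. Otherwise, with $L=t::L'$, let $r=\mathrm{Gb}(V,t)$; if $r=\mathrm{nil}$ return $\mathrm{nil}$; otherwise let $r'=\mathrm{Gbs}(V,L')$ and return the concatenation of $r$ and $r'$ if $r'\ne\mathrm{nil}$, and $\mathrm{nil}$ otherwise. *)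

theory Defs
  imports Main
begin

datatype kind = Request | Acknowledgment
datatype direction = Input | Output
datatype state_type = BOX | TRANSIENT

type_synonym 'h wire = "'h \<times> kind \<times> direction"

record ('s, 'h) xdi =
  states :: "'s set"
  init :: 's
  type_of :: "'s \<Rightarrow> state_type"
  transitions :: "'s \<Rightarrow> ('h wire \<times> 's) list"

text \<open>Uniqueness of the initial state is built into the record, which has a single \<open>init\<close> field.
  The fields \<open>type_of\<close> and \<open>transitions\<close> are irrelevant outside \<open>states X\<close>.\<close>

definition valid_xdi :: "('s, 'h) xdi \<Rightarrow> bool" where
  "valid_xdi X \<longleftrightarrow>
     finite (states X) \<and> init X \<in> states X \<and>
     (\<forall>s \<in> states X. \<forall>(w, s') \<in> set (transitions X s). s' \<in> states X)"

type_synonym 'h environment = "('h \<times> kind) set"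

definition step :: "('s, 'h) xdi \<Rightarrow> 'h environment \<Rightarrow> 's \<Rightarrow> 's list" where
  "step X E s = [s'. ((h, k, d), s') \<leftarrow> transitions X s, (h, k) \<notin> E]"

definition is_trace :: "('s, 'h) xdi \<Rightarrow> 'h environment \<Rightarrow> 's list \<Rightarrow> bool" where
  "is_trace X E ss \<longleftrightarrow>
     ss \<noteq> [] \<and> set ss \<subseteq> states X \<and> successively (\<lambda>s t. t \<in> set (step X E s)) ss"

lemma step_in_states:
  assumes "valid_xdi X" "s \<in> states X"
  shows "set (step X E s) \<subseteq> states X"
  using assms unfolding valid_xdi_def step_def by (fastforce split: if_splits)

text \<open>The recursive functions below need not terminate on machines that are not valid, so they are
  introduced together with a domain predicate. On valid machines, every call on states of the
  machine is shown to lie in the domain, and the recursion equations are derived there.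
  \<open>visits X h f ts r\<close> processes the transition list \<open>ts\<close> of a state carrying the flag \<open>f\<close>.\<close>

function (domintros)
  visit :: "('s, 'h) xdi \<Rightarrow> 'h \<Rightarrow> 's \<Rightarrow> bool \<Rightarrow> ('s \<times> bool) list \<Rightarrow> ('s \<times> bool) list" and
  visits :: "('s, 'h) xdi \<Rightarrow> 'h \<Rightarrow> bool \<Rightarrow> ('h wire \<times> 's) list \<Rightarrow> ('s \<times> bool) list \<Rightarrow> ('s \<times> bool) list"
where
  "visit X h s f r =
     (if map_of r s \<noteq> None then r else visits X h f (transitions X s) ((s, f) # r))"
| "visits X h f [] r = r"
| "visits X h f ((w, s') # ts) r =
     visits X h f ts (visit X h s' (if fst w = h then \<not> f else f) r)"
  by pat_completeness auto

definition blocking :: "('s, 'h) xdi \<Rightarrow> 'h \<Rightarrow> 's \<Rightarrow> bool" where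
  "blocking X h s \<longleftrightarrow> map_of (visit X h (init X) False []) s = Some True"

definition G_spec :: "('s, 'h) xdi \<Rightarrow> 'h \<Rightarrow> 's \<Rightarrow> 'h environment \<Rightarrow> bool" where
  "G_spec X h s E \<longleftrightarrow>
     (\<forall>ss. is_trace X E ss \<and> hd ss = s \<longrightarrow>
        type_of X (last ss) = TRANSIENT \<or> blocking X h (last ss))"

function (domintros)
  Gb :: "('s, 'h) xdi \<Rightarrow> 'h \<Rightarrow> 'h environment \<Rightarrow> 's list \<Rightarrow> 's \<Rightarrow> 's list" and
  Gbs :: "('s, 'h) xdi \<Rightarrow> 'h \<Rightarrow> 'h environment \<Rightarrow> 's list \<Rightarrow> 's list \<Rightarrow> 's list"
where
  "Gb X h E V s =
     (if s \<in> set V then V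
      else if type_of X s = TRANSIENT \<or> blocking X h s
      then Gbs X h E (s # V) (removeAll s (step X E s))
      else [])"
| "Gbs X h E V [] = V"
| "Gbs X h E V (t # L) =
     (let r = Gb X h E V t in
      if r = [] then []
      else let r' = Gbs X h E V L in
           if r' \<noteq> [] then r @ r' else [])"
  by pat_completeness auto


lemma card_Diff_insert_less:
  assumes "finite S" "s \<in> S" "s \<notin> A"
  shows "card (S - insert s A) < card (S - A)"
  using assms by (intro psubset_card_mono) auto

lemma visit_visits_keys_mono:
  "visit_visits_dom (Inl (X, h, s, f, r)) \<Longrightarrow> fst ` set r \<subseteq> fst ` set (visit X h s f r)"
  "visit_visits_dom (Inr (X, h, f, ts, r)) \<Longrightarrow> fst ` set r \<subseteq> fst ` set (visits X h f ts r)"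
proof (induction X h s f r and X h f ts r rule: visit_visits.pinduct)
  case (1 X h s f r)
  then show ?case by (auto simp: visit.psimps)
next
  case (2 X h f r)
  then show ?case by (simp add: visits.psimps)
next
  case (3 X h f w s' ts r)
  then show ?case by (simp add: visits.psimps)
qed

lemma visit_visits_termination:
  assumes "valid_xdi X"
  shows "s \<in> states X \<Longrightarrow> visit_visits_dom (Inl (X, h, s, f, r))"
    and "snd ` set ts \<subseteq> states X \<Longrightarrow> visit_visits_dom (Inr (X, h, f, ts, r))"
proof -
  have fin: "finite (states X)" using assms by (simp add: valid_xdi_def)
  have "card (states X - fst ` set r) < n \<Longrightarrow>
      (\<forall>s f. s \<in> states X \<longrightarrow> visit_visits_dom (Inl (X, h, s, f, r))) \<and>
      (\<forall>f ts. snd ` set ts \<subseteq> states X \<longrightarrow> visit_visits_dom (Inr (X, h, f, ts, r)))" for n r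
  proof (induction n arbitrary: r)
    case 0
    then show ?case by simp
  next
    case (Suc n)
    have visit: "visit_visits_dom (Inl (X, h, s, f, r'))"
      if s: "s \<in> states X" and r': "card (states X - fst ` set r') < Suc n" for s f r'
    proof (rule visit_visits.domintros(1))
      assume "map_of r' s = None"
      then have "s \<notin> fst ` set r'" by (simp add: map_of_eq_None_iff)
      then have "card (states X - fst ` set ((s, f) # r')) < n"
        using card_Diff_insert_less[OF fin s, of "fst ` set r'"] r' by simp
      moreover have "snd ` set (transitions X s) \<subseteq> states X"
        using assms s unfolding valid_xdi_def by force
      ultimately show "visit_visits_dom (Inr (X, h, f, transitions X s, (s, f) # r'))"
        using Suc.IH by blast
    qed
    have visits: "visit_visits_dom (Inr (X, h, f, ts, r'))"
      if "snd ` set ts \<subseteq> states X" "card (states X - fst ` set r') < Suc n" for f ts r'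
      using that
    proof (induction ts arbitrary: r')
      case Nil
      show ?case by (rule visit_visits.domintros(2))
    next
      case (Cons a ts)
      obtain w s' where a: "a = (w, s')" by (cases a)
      have d: "visit_visits_dom (Inl (X, h, s', g, r'))" for g
        using visit Cons.prems a by simp
      have "card (states X - fst ` set (visit X h s' g r')) \<le> card (states X - fst ` set r')" for g
        using visit_visits_keys_mono(1)[OF d] fin by (intro card_mono) auto
      then have "visit_visits_dom (Inr (X, h, f, ts, visit X h s' g r'))" for g
        using Cons.prems by (intro Cons.IH) (auto intro: le_less_trans)
      with d show ?case
        unfolding a by (intro visit_visits.domintros(3)) (simp_all only: simp_thms)
    qed
    show ?case using Suc.prems by (intro conjI allI impI visit visits)
  qed
  from this[OF lessI] show "s \<in> states X \<Longrightarrow> visit_visits_dom (Inl (X, h, s, f, r))"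
    and "snd ` set ts \<subseteq> states X \<Longrightarrow> visit_visits_dom (Inr (X, h, f, ts, r))"
    by blast+
qed

lemma visit_simps:
  assumes "valid_xdi X"
  shows "s \<in> states X \<Longrightarrow> visit X h s f r =
      (if map_of r s \<noteq> None then r else visits X h f (transitions X s) ((s, f) # r))"
    and "visits X h f [] r = r"
    and "snd ` set ((w, s') # ts) \<subseteq> states X \<Longrightarrow> visits X h f ((w, s') # ts) r =
      visits X h f ts (visit X h s' (if fst w = h then \<not> f else f) r)"
  by (rule visit.psimps visits.psimps; rule visit_visits_termination[OF assms]; simp)+

lemma Gb_Gbs_termination:
  assumes "valid_xdi X"
  shows "s \<in> states X \<Longrightarrow> Gb_Gbs_dom (Inl (X, h, E, V, s))"
    and "set L \<subseteq> states X \<Longrightarrow> Gb_Gbs_dom (Inr (X, h, E, V, L))"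
proof -
  have fin: "finite (states X)" using assms by (simp add: valid_xdi_def)
  have "card (states X - set V) < n \<Longrightarrow>
      (\<forall>s. s \<in> states X \<longrightarrow> Gb_Gbs_dom (Inl (X, h, E, V, s))) \<and>
      (\<forall>L. set L \<subseteq> states X \<longrightarrow> Gb_Gbs_dom (Inr (X, h, E, V, L)))" for n V
  proof (induction n arbitrary: V)
    case 0
    then show ?case by simp
  next
    case (Suc n)
    have Gb: "Gb_Gbs_dom (Inl (X, h, E, V, s))" if s: "s \<in> states X" for s
    proof -
      have "Gb_Gbs_dom (Inr (X, h, E, s # V, removeAll s (step X E s)))" if "s \<notin> set V"
      proof -
        have "card (states X - set (s # V)) < n"
          using card_Diff_insert_less[OF fin s that] Suc.prems by simp
        moreover have "set (removeAll s (step X E s)) \<subseteq> states X"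
          using step_in_states[OF assms s] by auto
        ultimately show ?thesis using Suc.IH by blast
      qed
      then show ?thesis by (intro Gb_Gbs.domintros(1))
    qed
    have "Gb_Gbs_dom (Inr (X, h, E, V, L))" if "set L \<subseteq> states X" for L
      using that by (induction L) (auto intro: Gb_Gbs.domintros Gb)
    with Gb show ?case by (intro conjI allI impI)
  qed
  from this[OF lessI] show "s \<in> states X \<Longrightarrow> Gb_Gbs_dom (Inl (X, h, E, V, s))"
    and "set L \<subseteq> states X \<Longrightarrow> Gb_Gbs_dom (Inr (X, h, E, V, L))"
    by blast+
qed

lemma Gb_simps:
  assumes "valid_xdi X"
  shows "s \<in> states X \<Longrightarrow> Gb X h E V s =
     (if s \<in> set V then V
      else if type_of X s = TRANSIENT \<or> blocking X h s
      then Gbs X h E (s # V) (removeAll s (step X E s))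
      else [])"
    and "Gbs X h E V [] = V"
    and "set (t # L) \<subseteq> states X \<Longrightarrow> Gbs X h E V (t # L) =
     (let r = Gb X h E V t in
      if r = [] then []
      else let r' = Gbs X h E V L in
           if r' \<noteq> [] then r @ r' else [])"
  by (rule Gb.psimps Gbs.psimps; rule Gb_Gbs_termination[OF assms]; simp)+

end

theory Submission imports Defs
begin

text \<open>The procedure passes only the ancestors of a state down the recursion, so success on \<open>s\<close> with
  accumulator \<open>V\<close> constrains exactly the traces from \<open>s\<close> that avoid \<open>V\<close>. Given such a trace, cut it
  at the last occurrence of \<open>s\<close>: either nothing follows, and the end point \<open>s\<close> was itself tested, or
  the rest is a shorter trace, from a successor of \<open>s\<close>, that avoids \<open>s # V\<close>.\<close>

text \<open>One failing call makes the whole list fail, and every element is tried with the same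
  \<open>V\<close>.\<close>

lemma Gbs_nonempty_imp_Gb_nonempty:
  assumes "valid_xdi X" "set L \<subseteq> states X" "Gbs X h E V L \<noteq> []" "t \<in> set L"
  shows "Gb X h E V t \<noteq> []"
  using assms(2-)
  by (induction L) (auto simp: Gb_simps[OF assms(1)] Let_def split: if_splits)

lemma Gb_nonempty_imp_trace_avoiding_end:
  assumes "valid_xdi X"
    and "Gb X h E V (hd ss) \<noteq> []" "is_trace X E ss" "set ss \<inter> set V = {}"
  shows "type_of X (last ss) = TRANSIENT \<or> blocking X h (last ss)"
  using assms(2-)
\<comment> \<open>Induction on length, since the cut may drop several states; \<open>V\<close>
  varies because it grows by \<open>?s\<close>.\<close>
proof (induction ss arbitrary: V rule: length_induct)
  case (1 ss)
  let ?s = "hd ss"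
  have "?s \<in> set ss" using 1(3) by (simp add: is_trace_def)
  then obtain ys zs where ss: "ss = ys @ ?s # zs" and last_occ: "?s \<notin> set zs"
    using split_list_last by metis
  have s: "?s \<in> states X" "?s \<notin> set V"
    using 1(3,4) \<open>?s \<in> set ss\<close> unfolding is_trace_def by blast+
  \<comment> \<open>Avoiding \<open>V\<close> excludes the branch that returns \<open>V\<close>
    untested.\<close>
  then have good: "type_of X ?s = TRANSIENT \<or> blocking X h ?s"
    and Gbs: "Gbs X h E (?s # V) (removeAll ?s (step X E ?s)) \<noteq> []"
    using 1(2) by (simp_all add: Gb_simps(1)[OF assms(1)] split: if_splits)
  have suc: "successively (\<lambda>s t. t \<in> set (step X E s)) (?s # zs)"
    using 1(3) ss unfolding is_trace_def by (metis successively_append_iff)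
  have last: "last ss = last (?s # zs)"
    using ss by (metis last_appendR list.distinct(1))
  show ?case
  proof (cases zs)
    case Nil
    with good last show ?thesis by simp
  next
    case (Cons t zs')
    \<comment> \<open>Cutting at the last occurrence gives \<open>t \<noteq> ?s\<close>, so
      \<open>t\<close> survives \<open>removeAll\<close>.\<close>
    have "t \<in> set (removeAll ?s (step X E ?s))"
      using suc last_occ Cons by auto
    then have "Gb X h E (?s # V) (hd zs) \<noteq> []"
      using Gbs_nonempty_imp_Gb_nonempty[OF assms(1) _ Gbs] step_in_states[OF assms(1) s(1)] Cons
      by auto
    moreover have sub: "set zs \<subseteq> set ss" "length zs < length ss"
      by (subst ss, force)+
    moreover have "is_trace X E zs"
      using 1(3) suc sub(1) Cons by (auto simp: is_trace_def)
    moreover have "set zs \<inter> set (?s # V) = {}"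
      using 1(4) sub(1) last_occ by auto
    ultimately have "type_of X (last zs) = TRANSIENT \<or> blocking X h (last zs)"
      using 1(1) by blast
    with last Cons show ?thesis by simp
  qed
qed

theorem lemma3:
  fixes X :: "('s, 'h) xdi" and h :: 'h and E :: "'h environment" and s :: 's
  assumes "valid_xdi X"
    and "s \<in> states X"
    and "Gb X h E [] s \<noteq> []"
  shows "G_spec X h s E"
  unfolding G_spec_def
  using Gb_nonempty_imp_trace_avoiding_end[OF assms(1), of h E "[]"] assms(3) by auto

end
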